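(* Let $X$ be a Banach space and let $S,T:X\to X$ be bounded linear operators with $\|S\|<1$ and $\|T\|<1$. For $w\in X$, let $A_{\mathcal{S}_w}$ denote the attractor of the iterated function system $\mathcal{S}_w=(X,f_1,f_2)$, where $f_1(x)=S(x)$ and $f_2(x)=T(x)+w$ for all $x\in X$. If the operator $S$ is compact, then there exists a family $(K_n)_{n\in\mathbb{N}}$ of compact subsets of $X$ such that $A_{\mathcal{S}_w}$ is not connected for all $w\in X\setminus\bigcup_{n\in\mathbb{N}}K_n$.
   Context: A contraction on a metric space $(X,d)$ is a map $f:X\to X$ for which there is $\lambda\in(0,1)$ with $d(f(x),f(y))\le\lambda d(x,y)$ for all $x,y\in X$. An iterated function system (IFS) on a complete metric space $X$ is a finite family of contractions $f_1,\dots,f_n:X\to X$. Its attractor is the unique nonempty compact set $A\subseteq X$ with $A=f_1(A)\cup\dots\cup f_n(A)$ (it exists and is unique, being the fixed point of the contraction $C\mapsto\bigcup_{k=1}^n f_k(C)$ on the nonempty compact subsets of $X$ with the Hausdorff–Pompeiu metric). Since $\|S\|,\|T\|<1$, the maps $f_1,f_2$ in the claim are contractions. *)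

theory Defs
  imports "HOL-Analysis.Analysis"
begin

definition contraction :: "('a::metric_space \<Rightarrow> 'a) \<Rightarrow> bool" where
  "contraction f \<longleftrightarrow> (\<exists>c. 0 < c \<and> c < 1 \<and> (\<forall>x y. dist (f x) (f y) \<le> c * dist x y))"

text \<open>An iterated function system on a complete metric space is given by the nonempty list
  of its maps.\<close>

definition ifs :: "('a::complete_space \<Rightarrow> 'a) list \<Rightarrow> bool" where
  "ifs fs \<longleftrightarrow> fs \<noteq> [] \<and> (\<forall>f\<in>set fs. contraction f)"

definition is_attractor :: "('a::complete_space \<Rightarrow> 'a) list \<Rightarrow> 'a set \<Rightarrow> bool" where
  "is_attractor fs A \<longleftrightarrow> A \<noteq> {} \<and> compact A \<and> A = (\<Union>f\<in>set fs. f ` A)"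

text \<open>The description is proper whenever \<open>ifs fs\<close> holds; see \<open>ex1_attractor\<close> below.\<close>

definition attractor :: "('a::complete_space \<Rightarrow> 'a) list \<Rightarrow> 'a set" where
  "attractor fs = (THE A. is_attractor fs A)"

definition compact_operator :: "('a::real_normed_vector \<Rightarrow>\<^sub>L 'b::real_normed_vector) \<Rightarrow> bool" where
  "compact_operator S \<longleftrightarrow> (\<forall>B. bounded B \<longrightarrow> compact (closure (blinfun_apply S ` B)))"

lemma ifs_common_ratio:
  assumes "ifs fs"
  obtains c where "0 < c" "c < 1" "\<And>f x y. f \<in> set fs \<Longrightarrow> dist (f x) (f y) \<le> c * dist x y"
proof -
  have "\<forall>f\<in>set fs. \<exists>c. 0 < c \<and> c < 1 \<and> (\<forall>x y. dist (f x) (f y) \<le> c * dist x y)"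
    using assms by (auto simp: ifs_def contraction_def)
  then obtain l where l: "\<And>f. f \<in> set fs \<Longrightarrow> 0 < l f \<and> l f < 1 \<and> (\<forall>x y. dist (f x) (f y) \<le> l f * dist x y)"
    by metis
  have ne: "l ` set fs \<noteq> {}" using assms by (auto simp: ifs_def)
  let ?c = "Max (l ` set fs)"
  have "?c \<in> l ` set fs" using ne by (intro Max_in) auto
  then have "0 < ?c" "?c < 1" using l by auto
  moreover have "dist (f x) (f y) \<le> ?c * dist x y" if "f \<in> set fs" for f x y
  proof -
    have "dist (f x) (f y) \<le> l f * dist x y" using l that by blast
    also have "\<dots> \<le> ?c * dist x y" using that by (intro mult_right_mono) auto
    finally show ?thesis .
  qed
  ultimately show ?thesis using that by blast
qed

lemma attractor_subset:
  assumes "ifs fs" and A: "is_attractor fs A" and B: "is_attractor fs B"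
  shows "A \<subseteq> B"
proof
  fix a0 assume a0: "a0 \<in> A"
  obtain c where c: "0 < c" "c < 1"
    and cf: "\<And>f x y. f \<in> set fs \<Longrightarrow> dist (f x) (f y) \<le> c * dist x y"
    using ifs_common_ratio[OF assms(1)] by blast
  have "bounded (A \<union> B)" using A B by (auto simp: is_attractor_def compact_imp_bounded)
  then obtain M where M: "\<And>x y. x \<in> A \<union> B \<Longrightarrow> y \<in> A \<union> B \<Longrightarrow> dist x y \<le> M"
    using bounded_two_points by metis
  have main: "\<exists>b\<in>B. dist a b \<le> c ^ n * M" if "a \<in> A" for a n
    using that
  proof (induction n arbitrary: a)
    case 0
    obtain b where "b \<in> B" using B by (auto simp: is_attractor_def)
    then show ?case using M[of a b] 0 by auto
  next
    case (Suc n)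
    have "a \<in> (\<Union>f\<in>set fs. f ` A)" using A Suc.prems by (metis is_attractor_def)
    then obtain f a' where f: "f \<in> set fs" "a' \<in> A" "a = f a'" by auto
    obtain b where b: "b \<in> B" "dist a' b \<le> c ^ n * M" using Suc.IH[OF f(2)] by blast
    have "f b \<in> (\<Union>f\<in>set fs. f ` B)" using f b by auto
    then have "f b \<in> B" using B by (metis is_attractor_def)
    moreover have "dist a (f b) \<le> c ^ Suc n * M"
    proof -
      have "dist a (f b) \<le> c * dist a' b" using cf f by auto
      also have "\<dots> \<le> c * (c ^ n * M)" using b c by (intro mult_left_mono) auto
      finally show ?thesis by (simp add: mult.assoc)
    qed
    ultimately show ?case by blast
  qed
  have "(\<lambda>n. c ^ n * M) \<longlonglongrightarrow> 0"
    using c by (intro tendsto_mult_left_zero LIMSEQ_power_zero) auto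
  have "a0 \<in> closure B"
    unfolding closure_approachable
  proof (intro allI impI)
    fix e :: real assume "0 < e"
    then have "\<forall>\<^sub>F n in sequentially. c ^ n * M < e"
      using \<open>(\<lambda>n. c ^ n * M) \<longlonglongrightarrow> 0\<close> order_tendstoD(2) by blast
    then obtain n where "c ^ n * M < e" by (auto simp: eventually_sequentially)
    then show "\<exists>y\<in>B. dist y a0 < e"
      using main[OF a0, of n] by (auto simp: dist_commute intro: le_less_trans)
  qed
  then show "a0 \<in> B" using B by (auto simp: is_attractor_def compact_imp_closed)
qed

lemma ex_attractor:
  assumes "ifs fs"
  shows "\<exists>A. is_attractor fs A"
proof -
  obtain c where c: "0 < c" "c < 1"
    and cf: "\<And>f x y. f \<in> set fs \<Longrightarrow> dist (f x) (f y) \<le> c * dist x y"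
    using ifs_common_ratio[OF assms] by blast
  obtain g where g: "g \<in> set fs" using assms that[of "hd fs"] by (simp add: ifs_def)
  have "\<exists>!x. x \<in> UNIV \<and> g x = x"
    using c cf[OF g] by (intro Banach_fix[of UNIV c g]) (auto simp: complete_UNIV)
  then obtain p where p: "g p = p" by blast
  define F where "F C = (\<Union>f\<in>set fs. f ` C)" for C
  define D where "D n = (F ^^ n) {p}" for n
  have D0: "D 0 = {p}" and DS: "D (Suc n) = F (D n)" for n by (auto simp: D_def)
  define P where "P = (\<Union>n. D n)"
  have finD: "finite (D n)" for n by (induction n) (auto simp: D0 DS F_def)
  have pP: "p \<in> P" using D0 unfolding P_def by blast
  have FP: "F P = P"
  proof -
    have "F P = (\<Union>n. D (Suc n))" by (auto simp: F_def P_def DS)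
    moreover have "p \<in> D (Suc 0)" unfolding DS D0 F_def using g by (intro UN_I[of g]) (auto simp: p)
    then have "D n \<subseteq> (\<Union>n. D (Suc n))" for n
      by (cases n) (auto simp: D0)
    then have "P \<subseteq> (\<Union>n. D (Suc n))" by (auto simp: P_def)
    ultimately show ?thesis by (auto simp: P_def)
  qed
  define R where "R = (\<Sum>f\<in>set fs. dist (f p) p) / (1 - c)"
  have R: "dist (f p) p \<le> (1 - c) * R" if "f \<in> set fs" for f
    using that c by (auto simp: R_def intro!: member_le_sum)
  have near: "dist x p \<le> R" if "x \<in> D n" for x n
    using that
  proof (induction n arbitrary: x)
    case 0
    have "0 \<le> (1 - c) * R" using R[OF g] zero_le_dist order_trans by blast
    then show ?case using 0 c by (simp add: D0 zero_le_mult_iff)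
  next
    case (Suc n)
    then obtain f y where f: "f \<in> set fs" "y \<in> D n" "x = f y" by (auto simp: DS F_def)
    have "dist x p \<le> dist (f y) (f p) + dist (f p) p" using f dist_triangle by blast
    also have "\<dots> \<le> c * R + (1 - c) * R"
    proof (rule add_mono)
      have "c * dist y p \<le> c * R" using Suc.IH[OF f(2)] c by auto
      then show "dist (f y) (f p) \<le> c * R" using cf[OF f(1), of y p] by linarith
    qed (use R f in auto)
    also have "\<dots> = R" by (simp add: algebra_simps)
    finally show ?case .
  qed
  have approx: "\<exists>y\<in>D n. dist x y \<le> c ^ n * R" if "x \<in> P" for x n
    using that
  proof (induction n arbitrary: x)
    case 0
    then show ?case using near by (auto simp: D0 P_def)
  next
    case (Suc n)
    have "x \<in> F P" using Suc.prems FP by simp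
    then obtain f x' where f: "f \<in> set fs" "x' \<in> P" "x = f x'" by (auto simp: F_def)
    obtain y where y: "y \<in> D n" "dist x' y \<le> c ^ n * R" using Suc.IH[OF f(2)] by blast
    have "dist x (f y) \<le> c * dist x' y" using cf f by auto
    also have "\<dots> \<le> c * (c ^ n * R)" using y c by (intro mult_left_mono) auto
    finally have "dist x (f y) \<le> c ^ Suc n * R" by (simp add: mult.assoc)
    moreover have "f y \<in> D (Suc n)" using f y by (auto simp: DS F_def)
    ultimately show ?case by blast
  qed
  have lim: "(\<lambda>n. c ^ n * R) \<longlonglongrightarrow> 0"
    using c by (intro tendsto_mult_left_zero LIMSEQ_power_zero) auto
  have "compact (closure P)"
    unfolding compact_eq_totally_bounded
  proof (intro conjI allI impI)
    show "complete (closure P)" by (simp add: complete_eq_closed)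
    fix e :: real assume e: "0 < e"
    then have "\<forall>\<^sub>F n in sequentially. c ^ n * R < e / 2"
      using lim order_tendstoD(2)[of _ 0 _ "e / 2"] by simp
    then obtain n where n: "c ^ n * R < e / 2" by (auto simp: eventually_sequentially)
    have "closure P \<subseteq> (\<Union>x\<in>D n. ball x e)"
    proof
      fix x assume "x \<in> closure P"
      then obtain z where z: "z \<in> P" "dist z x < e / 2"
        using e by (metis closure_approachable half_gt_zero)
      obtain y where y: "y \<in> D n" "dist z y \<le> c ^ n * R" using approx[OF z(1)] by blast
      have "dist y x < e" using z y n dist_triangle3[of y x z] by linarith
      then show "x \<in> (\<Union>x\<in>D n. ball x e)" using y by auto
    qed
    then show "\<exists>k. finite k \<and> closure P \<subseteq> (\<Union>x\<in>k. ball x e)" using finD by blast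
  qed
  moreover have "F (closure P) = closure P"
  proof
    have cont: "continuous_on UNIV f" if "f \<in> set fs" for f
      using cf[OF that] c
      by (intro lipschitz_on_continuous_on[of c]) (auto simp: lipschitz_on_def)
    have fP: "f ` P \<subseteq> P" if "f \<in> set fs" for f using FP that by (auto simp: F_def)
    have "f ` closure P \<subseteq> closure P" if f: "f \<in> set fs" for f
      using fP[OF f] closure_subset[of P]
      by (intro image_closure_subset[OF continuous_on_subset[OF cont[OF f]]]) auto
    then show "F (closure P) \<subseteq> closure P" unfolding F_def by blast
    have "compact (F (closure P))"
      unfolding F_def
      using \<open>compact (closure P)\<close> continuous_on_subset[OF cont]
      by (intro compact_UN compact_continuous_image) auto
    moreover have "F P \<subseteq> F (closure P)" using closure_subset[of P] unfolding F_def by blast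
    then have "P \<subseteq> F (closure P)" by (simp add: FP)
    ultimately show "closure P \<subseteq> F (closure P)"
      by (simp add: closure_minimal compact_imp_closed)
  qed
  ultimately show ?thesis
    using pP closure_subset[of P] unfolding is_attractor_def F_def by blast
qed

lemma ex1_attractor: "ifs fs \<Longrightarrow> \<exists>!A. is_attractor fs A"
  using ex_attractor attractor_subset by (metis subset_antisym)

lemma is_attractor_attractor: "ifs fs \<Longrightarrow> is_attractor fs (attractor fs)"
  unfolding attractor_def by (rule theI'[OF ex1_attractor])

lemma contraction_affine:
  fixes T :: "'a::real_normed_vector \<Rightarrow>\<^sub>L 'a"
  assumes "norm T < 1"
  shows "contraction (\<lambda>x. blinfun_apply T x + w)"
  unfolding contraction_def
proof (intro exI[of _ "max (norm T) (1/2)"] conjI allI)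
  fix x y
  have "dist (T x + w) (T y + w) \<le> norm T * dist x y"
    by (simp add: dist_norm norm_blinfun flip: blinfun.diff_right)
  also have "\<dots> \<le> max (norm T) (1/2) * dist x y" by (intro mult_right_mono) auto
  finally show "dist (T x + w) (T y + w) \<le> max (norm T) (1/2) * dist x y" .
qed (use assms in auto)

lemma ifs_affine_pair:
  fixes S T :: "'a::banach \<Rightarrow>\<^sub>L 'a"
  assumes "norm S < 1" "norm T < 1"
  shows "ifs [\<lambda>x. blinfun_apply S x, \<lambda>x. blinfun_apply T x + w]"
  using contraction_affine[OF assms(1), of 0] contraction_affine[OF assms(2)]
  by (auto simp: ifs_def)

end

theory Submission
  imports Defs
begin

text \<open>Write \<open>f x = T x + w\<close> and let \<open>A\<close> be the attractor. If \<open>A\<close> is connected, then its compact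
  pieces \<open>S A\<close> and \<open>f A\<close> meet, say \<open>S a = f b\<close> with \<open>a, b \<in> A\<close>. Now unfold the address of \<open>b\<close>.
  Either \<open>b = f\<^sup>k (S c)\<close> for some \<open>k\<close> and some \<open>c \<in> A\<close>, and then with \<open>m = k + 1\<close>
  \<open>w - T\<^sup>m w = (I - T) (S a) - T\<^sup>m (I - T) (S c)\<close>; or \<open>b\<close> lies in every \<open>f\<^sup>k A\<close>, hence is the
  fixed point of \<open>f\<close>, and \<open>w = (I - T) (S a)\<close>. Since \<open>S\<close> is compact and \<open>I - T\<^sup>m\<close> has a continuous
  inverse, the \<open>w\<close> arising from given \<open>k\<close> and a given bound on \<open>A\<close> lie in a compact set, and there
  are countably many such data.\<close>

text \<open>\<open>I - L\<close> is bounded below by \<open>1 - c\<close>, and it is onto because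
  \<open>x - L x = v\<close> says that \<open>x\<close> is a fixed point of the contraction sending
  \<open>x\<close> to \<open>L x + v\<close>. Its inverse is therefore Lipschitz and carries
  \<open>C\<close> to the set in question.\<close>

lemma compact_vimage_diff_contraction:
  fixes L :: "'a::banach \<Rightarrow> 'a"
  assumes L: "bounded_linear L" and c: "0 \<le> c" "c < 1"
    and bound: "\<And>x. norm (L x) \<le> c * norm x" and "compact C"
  shows "compact {x. x - L x \<in> C}"
proof -
  interpret bounded_linear L by (rule L)
  have lower: "(1 - c) * norm (x - y) \<le> norm ((x - L x) - (y - L y))" for x y
  proof -
    have "norm (x - y) - norm (L (x - y)) \<le> norm ((x - y) - L (x - y))"
      by (rule norm_triangle_ineq2)
    with bound[of "x - y"] show ?thesis by (simp add: diff algebra_simps)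
  qed
  have "\<exists>x. x - L x = v" for v
  proof -
    have "\<exists>!x. x \<in> UNIV \<and> L x + v = x"
      using c bound by (intro Banach_fix[of UNIV c]) (auto simp: complete_UNIV dist_norm simp flip: diff)
    then show ?thesis by (metis add_diff_cancel_left')
  qed
  then obtain g where g: "\<And>v. g v - L (g v) = v" by metis
  have "{x. x - L x \<in> C} = g ` C"
  proof (intro equalityI subsetI)
    fix x assume x: "x \<in> {x. x - L x \<in> C}"
    have "(1 - c) * norm (x - g (x - L x)) \<le> 0"
      using lower[of x "g (x - L x)"] by (simp add: g)
    then have "x = g (x - L x)" using c by (simp add: mult_le_0_iff)
    with x show "x \<in> g ` C" by blast
  qed (auto simp: g)
  moreover have "(1 / (1 - c))-lipschitz_on C g"
    using lower[of "g _" "g _"] c by (auto simp: lipschitz_on_def dist_norm g field_simps)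
  ultimately show ?thesis
    using \<open>compact C\<close> by (simp add: compact_continuous_image lipschitz_on_continuous_on)
qed

lemma bounded_linear_funpow:
  fixes f :: "'a::real_normed_vector \<Rightarrow> 'a"
  assumes "bounded_linear f"
  shows "bounded_linear (f ^^ n)"
  using assms by (induction n) (auto simp: id_def comp_def intro: bounded_linear_compose)

lemma norm_blinfun_funpow:
  fixes T :: "'a::real_normed_vector \<Rightarrow>\<^sub>L 'a"
  shows "norm ((blinfun_apply T ^^ n) x) \<le> norm T ^ n * norm x"
proof (induction n)
  case (Suc n)
  have "norm ((blinfun_apply T ^^ Suc n) x) \<le> norm T * norm ((blinfun_apply T ^^ n) x)"
    by (simp add: norm_blinfun)
  also have "\<dots> \<le> norm T * (norm T ^ n * norm x)" using Suc by (intro mult_left_mono) auto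
  finally show ?case by (simp add: mult.assoc)
qed simp

lemma funpow_affine_diff:
  fixes T :: "'a::real_normed_vector \<Rightarrow>\<^sub>L 'a"
  defines "f w \<equiv> \<lambda>x. T x + w"
  shows "(f w ^^ n) x - (f w ^^ n) y = (blinfun_apply T ^^ n) (x - y)"
  by (induction n) (auto simp: f_def simp flip: blinfun.diff_right)

text \<open>The \<open>n\<close>-th iterate adds to \<open>T^n x\<close> the sum of
  \<open>T^i w\<close> over \<open>i < n\<close>; applying \<open>I - T\<close> makes this sum
  telescope.\<close>

lemma funpow_affine_defect:
  fixes T :: "'a::real_normed_vector \<Rightarrow>\<^sub>L 'a"
  defines "f w \<equiv> \<lambda>x. T x + w"
  shows "(f w ^^ n) x - T ((f w ^^ n) x)
    = (blinfun_apply T ^^ n) (x - T x) + (w - (blinfun_apply T ^^ n) w)"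
proof (induction n)
  case (Suc n)
  have "(f w ^^ Suc n) x - T ((f w ^^ Suc n) x)
      = T ((f w ^^ n) x - T ((f w ^^ n) x)) + (w - T w)"
    by (simp add: f_def blinfun.bilinear_simps)
  also have "\<dots> = (blinfun_apply T ^^ Suc n) (x - T x) + (w - (blinfun_apply T ^^ Suc n) w)"
    unfolding Suc by (simp add: blinfun.bilinear_simps)
  finally show ?case .
qed simp

text \<open>The two pieces are closed, nonempty and cover \<open>A\<close>; if disjoint, they would
  separate it.\<close>

lemma attractor_pair_connected_meet:
  assumes A: "is_attractor [f, g] A" and "connected A"
    and "continuous_on A f" "continuous_on A g"
  obtains a b where "a \<in> A" "b \<in> A" "f a = g b"
proof -
  have "compact A" "A \<noteq> {}" and AE: "A = f ` A \<union> g ` A"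
    using A by (auto simp: is_attractor_def)
  then have "closed (f ` A)" "closed (g ` A)"
    using assms by (auto intro: compact_imp_closed compact_continuous_image)
  moreover have "f ` A \<inter> A \<noteq> {}" "g ` A \<inter> A \<noteq> {}" "A \<subseteq> f ` A \<union> g ` A"
    using AE \<open>A \<noteq> {}\<close> by blast+
  ultimately have "f ` A \<inter> g ` A \<inter> A \<noteq> {}"
    using \<open>connected A\<close> unfolding connected_closed by blast
  then show thesis using that by blast
qed

text \<open>Keep taking preimages under \<open>g\<close>. If this never leads to a point of
  \<open>f\<close> A\<open>, every preimage found in\<close>A\<open>lies in\<close>g
  \<open>A\<close> again, and the process never stops.\<close>

lemma funpow_address_cases:
  assumes "A \<subseteq> f ` A \<union> g ` A" "b \<in> A"
  shows "(\<exists>k. \<exists>c\<in>A. b = (g ^^ k) (f c)) \<or> (\<forall>k. \<exists>c\<in>A. b = (g ^^ k) c)"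
proof (rule disjCI)
  assume *: "\<not> (\<forall>k. \<exists>c\<in>A. b = (g ^^ k) c)"
  show "\<exists>k. \<exists>c\<in>A. b = (g ^^ k) (f c)"
  proof (rule ccontr)
    assume no: "\<not> ?thesis"
    have "\<exists>c\<in>A. b = (g ^^ k) c" for k
    proof (induction k)
      case (Suc k)
      then obtain c where "c \<in> A" "b = (g ^^ k) c" by blast
      with no assms(1) obtain d where "d \<in> A" "c = g d" by blast
      then show ?case using \<open>b = _\<close> by (auto simp: funpow_swap1)
    qed (use assms in auto)
    with * show False by blast
  qed
qed

text \<open>If \<open>b\<close> is the \<open>k\<close>-th iterate of \<open>c\<close>, then
  \<open>f w b - b\<close> is \<open>T^k (f w c - c)\<close>. Both \<open>f w c\<close> and
  \<open>c\<close> lie in the bounded set \<open>A\<close>, so this tends to 0 uniformly in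
  \<open>c\<close>.\<close>

lemma affine_fixed_point_if_funpow:
  fixes T :: "'a::real_normed_vector \<Rightarrow>\<^sub>L 'a"
  defines "f w \<equiv> \<lambda>x. T x + w"
  assumes "norm T < 1" "bounded A" "f w ` A \<subseteq> A" and b: "\<And>k. \<exists>c\<in>A. b = (f w ^^ k) c"
  shows "f w b = b"
proof -
  obtain M where M: "\<And>x y. x \<in> A \<Longrightarrow> y \<in> A \<Longrightarrow> dist x y \<le> M"
    using bounded_two_points \<open>bounded A\<close> by metis
  have "norm (f w b - b) \<le> norm T ^ k * M" for k
  proof -
    obtain c where c: "c \<in> A" "b = (f w ^^ k) c" using b by blast
    then have "f w b - b = (f w ^^ k) (f w c) - (f w ^^ k) c" by (simp add: funpow_swap1)
    also have "\<dots> = (blinfun_apply T ^^ k) (f w c - c)" unfolding f_def by (rule funpow_affine_diff)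
    finally have "norm (f w b - b) \<le> norm T ^ k * dist (f w c) c"
      using norm_blinfun_funpow by (simp add: dist_norm)
    also have "\<dots> \<le> norm T ^ k * M"
      using c assms M by (intro mult_left_mono) auto
    finally show ?thesis .
  qed
  moreover have "(\<lambda>k. norm T ^ k * M) \<longlonglongrightarrow> 0"
    using \<open>norm T < 1\<close> by (intro tendsto_mult_left_zero LIMSEQ_power_zero) auto
  ultimately have "norm (f w b - b) \<le> 0"
    by (intro LIMSEQ_le_const[of _ 0]) auto
  then show ?thesis by simp
qed

theorem theorem4p1:
  fixes S T :: "'a::banach \<Rightarrow>\<^sub>L 'a"
  assumes "norm S < 1" and "norm T < 1"
    and "compact_operator S"
  shows "\<exists>K :: nat \<Rightarrow> 'a set. (\<forall>n. compact (K n)) \<and>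
    (\<forall>w \<in> UNIV - (\<Union>n. K n).
       \<not> connected (attractor [\<lambda>x. blinfun_apply S x, \<lambda>x. blinfun_apply T x + w]))"
proof -
  \<comment> \<open>The attractor varies with \<open>w\<close>, so no single ball is known to
    contain them all; natural radii keep the family countable.\<close>
  define E where "E R = (\<lambda>x. x - T x) ` closure (blinfun_apply S ` cball 0 (real R))" for R
  define F where "F R m = (\<lambda>(x, y). x - (blinfun_apply T ^^ m) y) ` (E R \<times> E R)" for R m
  define G where "G R m = {w. w - (blinfun_apply T ^^ m) w \<in> F R m}" for R m
  have lin: "bounded_linear (blinfun_apply T ^^ m)" for m
    by (intro bounded_linear_funpow blinfun.bounded_linear_right)
  have E: "compact (E R)" for R
    unfolding E_def using \<open>compact_operator S\<close>
    by (intro compact_continuous_image continuous_intros) (auto simp: compact_operator_def)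
  have F: "compact (F R m)" for R m
    unfolding F_def case_prod_unfold
    by (intro compact_continuous_image compact_Times E continuous_intros
        bounded_linear.continuous_on[OF lin])
  \<comment> \<open>The exponent must be positive: for exponent 0 the operator
    \<open>I - T^0\<close> vanishes.\<close>
  have G: "compact (G R (Suc k))" for R k
    unfolding G_def
  proof (rule compact_vimage_diff_contraction[OF lin _ _ norm_blinfun_funpow F])
    have "norm T ^ Suc k \<le> norm T" using \<open>norm T < 1\<close> by (simp add: mult_left_le power_le_one)
    with \<open>norm T < 1\<close> show "norm T ^ Suc k < 1" by linarith
  qed simp
  \<comment> \<open>The sets \<open>E R\<close> catch the \<open>w\<close> for which
    \<open>b\<close> is the fixed point, the sets \<open>G R (Suc k)\<close> those with a finite
    address.\<close>
  define K where "K = range E \<union> range (\<lambda>(R, k). G R (Suc k))"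
  have "K \<noteq> {}" "countable K" by (auto simp: K_def)
  then have K: "range (from_nat_into K) = K" by (rule range_from_nat_into)
  have "compact (from_nat_into K n)" for n
    using from_nat_into[OF \<open>K \<noteq> {}\<close>, of n] E G by (auto simp: K_def)
  moreover have "w \<in> \<Union> K"
    if conn: "connected (attractor [\<lambda>x. blinfun_apply S x, \<lambda>x. blinfun_apply T x + w])" for w
  proof -
    define f where "f = (\<lambda>x. T x + w)"
    define A where "A = attractor [blinfun_apply S, f]"
    have A: "is_attractor [blinfun_apply S, f] A"
      unfolding A_def f_def using ifs_affine_pair assms by (intro is_attractor_attractor) auto
    have "connected A" using conn by (simp add: A_def f_def)
    obtain a b where ab: "a \<in> A" "b \<in> A" "S a = f b"
      using A \<open>connected A\<close>
      by (rule attractor_pair_connected_meet) (auto simp: f_def intro!: continuous_intros)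
    have AE: "A = blinfun_apply S ` A \<union> f ` A" and "bounded A"
      using A by (auto simp: is_attractor_def compact_imp_bounded)
    obtain r where r: "\<And>x. x \<in> A \<Longrightarrow> norm x \<le> r" using \<open>bounded A\<close> by (auto simp: bounded_iff)
    obtain R :: nat where "r \<le> R" using real_arch_simple by blast
    then have "A \<subseteq> cball 0 R" using r by force
    then have inE: "S x - T (S x) \<in> E R" if "x \<in> A" for x
      unfolding E_def using that closure_subset by blast
    consider k c where "c \<in> A" "b = (f ^^ k) (S c)" | "\<And>k. \<exists>c\<in>A. b = (f ^^ k) c"
      using funpow_address_cases[of A S f b] AE ab by blast
    then show ?thesis
    proof cases
      case (1 k c)
      then have "S a = (f ^^ Suc k) (S c)" using ab by simp
      then have "S a - T (S a) = (blinfun_apply T ^^ Suc k) (S c - T (S c))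
          + (w - (blinfun_apply T ^^ Suc k) w)"
        using funpow_affine_defect[where T = T and w = w and n = "Suc k" and x = "S c"] by (simp only: f_def)
      then have "w - (blinfun_apply T ^^ Suc k) w
          = (S a - T (S a)) - (blinfun_apply T ^^ Suc k) (S c - T (S c))"
        by (simp only: add_diff_cancel_left')
      then have "w \<in> G R (Suc k)"
        unfolding G_def F_def mem_Collect_eq
        by (intro image_eqI[of _ _ "(S a - T (S a), S c - T (S c))"])
          (use inE[OF ab(1)] inE[OF 1(1)] in \<open>simp_all only: case_prod_conv mem_Times_iff fst_conv snd_conv simp_thms\<close>)
      then show ?thesis by (auto simp: K_def)
    next
      case 2
      have "f b = b"
        using affine_fixed_point_if_funpow[where T = T and w = w and A = A and b = b] assms(2) \<open>bounded A\<close> AE 2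
        unfolding f_def by blast
      \<comment> \<open>Here \<open>S a = f b = b\<close>, so \<open>S a\<close> is itself the fixed
        point of \<open>f\<close>.\<close>
      then have "w = S a - T (S a)" using ab by (simp add: f_def eq_diff_eq add.commute)
      then show ?thesis using inE[OF ab(1)] by (auto simp: K_def)
    qed
  qed
  ultimately show ?thesis
    using K by (intro exI[of _ "from_nat_into K"]) auto
qed

end
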